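(* Let $N>1/4$ be a rational number, and let $\mathcal{E}_N$ be the elliptic curve over $\mathbb{Q}$ given by $v^2=u^3+2(2N^2+2N-1)u^2-(4N-1)u$. If $\mathcal{E}_N$ has positive rank (over $\mathbb{Q}$), then there are infinitely many rational and integer triangles with $R/r=N$.
   Context: A rational (respectively integer) triangle is a non-degenerate triangle whose side lengths $f,g,h$ are rational numbers (respectively integers). $R$ denotes the radius of its circumcircle and $r$ the radius of the excircle touching the side $h$ from outside (tangent to the side $h$ and to the extensions of the sides $f$ and $g$); explicitly $\frac{R}{r}=\frac{2fgh}{(f+g+h)(f-g-h)(g-h-f)}$. *)

theory Defs
  imports "HOL-Analysis.Analysis" "HOL-Algebra.FiniteProduct" "HOL-Library.Extended_Nat"
begin

datatype 'a ec_point = Pt_Infinity | Pt 'a 'a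

text \<open>
  The chord-and-tangent law on \<open>y\<^sup>2 = x\<^sup>3 + a x\<^sup>2 + b x + c\<close>. In the doubling branch the guard
  has already excluded \<open>y1 = -y2\<close>, so for points of the curve \<open>y1 = y2 \<noteq> 0\<close> there.
\<close>
fun ec_add :: "'a::field \<Rightarrow> 'a \<Rightarrow> 'a ec_point \<Rightarrow> 'a ec_point \<Rightarrow> 'a ec_point" where
  "ec_add a b Pt_Infinity Q = Q"
| "ec_add a b P Pt_Infinity = P"
| "ec_add a b (Pt x1 y1) (Pt x2 y2) =
     (if x1 = x2 \<and> y1 = - y2 then Pt_Infinity
      else let m = (if x1 = x2 then (3 * x1^2 + 2 * a * x1 + b) / (2 * y1)
                    else (y2 - y1) / (x2 - x1));
               x3 = m^2 - a - x1 - x2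
           in Pt x3 (m * (x1 - x3) - y1))"

text \<open>
  The Mordell-Weil group. It is an abelian group when the curve is nonsingular and the
  characteristic is not 2; the definition itself does not require this.
\<close>
definition ec_group :: "'a::field \<Rightarrow> 'a \<Rightarrow> 'a \<Rightarrow> 'a ec_point monoid" where
  "ec_group a b c =
     \<lparr>carrier = insert Pt_Infinity {Pt x y | x y. y^2 = x^3 + a * x^2 + b * x + c},
      mult = ec_add a b,
      one = Pt_Infinity\<rparr>"

definition Z_independent :: "('a, 'b) monoid_scheme \<Rightarrow> 'a set \<Rightarrow> bool" where
  "Z_independent G S \<longleftrightarrow>
     finite S \<and> S \<subseteq> carrier G \<and>
     (\<forall>c :: 'a \<Rightarrow> int.
        finprod G (\<lambda>s. s [^]\<^bsub>G\<^esub> c s) S = \<one>\<^bsub>G\<^esub> \<longrightarrow> (\<forall>s\<in>S. c s = 0))"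

text \<open>The (torsion-free) rank of an abelian group, written multiplicatively.\<close>
definition ab_rank :: "('a, 'b) monoid_scheme \<Rightarrow> enat" where
  "ab_rank G = (SUP S \<in> {S. Z_independent G S}. enat (card S))"

definition curve_E :: "rat \<Rightarrow> rat ec_point monoid" where
  "curve_E N = ec_group (2 * (2 * N^2 + 2 * N - 1)) (- (4 * N - 1)) 0"

text \<open>
  A triangle is given by its vertices \<open>(A, B, C)\<close>; the sides are
  \<open>f = dist B C\<close>, \<open>g = dist C A\<close>, \<open>h = dist A B\<close>, so \<open>h\<close> is opposite \<open>C\<close>.
\<close>
type_synonym plane_triangle = "(real^2) \<times> (real^2) \<times> (real^2)"

fun nondegenerate :: "plane_triangle \<Rightarrow> bool" where
  "nondegenerate (A, B, C) \<longleftrightarrow> \<not> collinear {A, B, C}"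

fun side_lengths_in :: "real set \<Rightarrow> plane_triangle \<Rightarrow> bool" where
  "side_lengths_in K (A, B, C) \<longleftrightarrow> dist B C \<in> K \<and> dist C A \<in> K \<and> dist A B \<in> K"

definition rational_triangle :: "plane_triangle \<Rightarrow> bool" where
  "rational_triangle T \<longleftrightarrow> nondegenerate T \<and> side_lengths_in \<rat> T"

definition integer_triangle :: "plane_triangle \<Rightarrow> bool" where
  "integer_triangle T \<longleftrightarrow> nondegenerate T \<and> side_lengths_in \<int> T"

fun is_circumradius :: "plane_triangle \<Rightarrow> real \<Rightarrow> bool" where
  "is_circumradius (A, B, C) R \<longleftrightarrow> (\<exists>Z. {A, B, C} \<subseteq> sphere Z R)"

definition tangent_at :: "(real^2) \<Rightarrow> real \<Rightarrow> (real^2) \<Rightarrow> (real^2) \<Rightarrow> (real^2) \<Rightarrow> bool" where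
  "tangent_at Z r X Y P \<longleftrightarrow> sphere Z r \<inter> affine hull {X, Y} = {P}"

text \<open>
  The circle touches the side \<open>A B\<close> in an inner point \<open>P\<close>, and the lines \<open>C A\<close>, \<open>C B\<close> in
  points \<open>Q\<close>, \<open>S\<close> beyond \<open>A\<close>, \<open>B\<close>. The positions of \<open>Q\<close> and \<open>S\<close> separate this excircle from
  the incircle and from the other two excircles.
\<close>
fun is_exradius :: "plane_triangle \<Rightarrow> real \<Rightarrow> bool" where
  "is_exradius (A, B, C) r \<longleftrightarrow>
     r > 0 \<and>
     (\<exists>Z P Q S.
        tangent_at Z r A B P \<and> P \<in> open_segment A B \<and>
        tangent_at Z r C A Q \<and> A \<in> open_segment C Q \<and>
        tangent_at Z r C B S \<and> B \<in> open_segment C S)"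

text \<open>For a nondegenerate triangle both radii exist and are unique.\<close>
definition radius_ratio :: "plane_triangle \<Rightarrow> real \<Rightarrow> bool" where
  "radius_ratio T q \<longleftrightarrow> (\<exists>R r. is_circumradius T R \<and> is_exradius T r \<and> R / r = q)"

fun similar :: "plane_triangle \<Rightarrow> plane_triangle \<Rightarrow> bool" where
  "similar (A, B, C) (A', B', C') \<longleftrightarrow>
     (\<exists>k F. k > 0 \<and> (\<forall>x y. dist (F x) (F y) = k * dist x y) \<and> F ` {A, B, C} = {A', B', C'})"

text \<open>
  Since the ratio of the radii is invariant under scaling and congruence, "infinitely many
  triangles" is counted up to similarity.
\<close>
definition infinitely_many_triangles :: "(plane_triangle \<Rightarrow> bool) \<Rightarrow> bool" where
  "infinitely_many_triangles P \<longleftrightarrow>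
     (\<exists>\<T>. infinite \<T> \<and> (\<forall>T\<in>\<T>. P T) \<and> pairwise (\<lambda>T T'. \<not> similar T T') \<T>)"

end

theory Submission imports Defs
begin

text \<open>
  Write the sides as \<open>f = y + z\<close>, \<open>g = z + x\<close>, \<open>h = x + y\<close> with \<open>x, y, z > 0\<close>; then \<open>R / r = N\<close> becomes
  \<open>(x + y) (y + z) (z + x) = 4 N (x + y + z) x y\<close>. Put \<open>t = (1 - u) / (4 N)\<close>. With \<open>x + y = 1\<close> and
  \<open>z = t - 1\<close> the equation says \<open>x y = - t (t - 1) / u\<close>, and the discriminant \<open>1 - 4 x y\<close> equals
  \<open>(v / (2 N u))\<^sup>2\<close> exactly when \<open>(u, v)\<close> lies on the curve. A point with \<open>u < 0\<close> gives a positive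
  solution directly if \<open>t > 1\<close>, and after an exchange of the unknowns if \<open>t < 1\<close>. Positive rank gives
  infinitely many points, and the involution \<open>u \<mapsto> (1 - 4 N) / u\<close> (translation by the 2-torsion point)
  gives infinitely many with \<open>u < 0\<close>. Each similarity class belongs to finitely many \<open>u\<close>, because \<open>t\<close>
  is one of finitely many ratios formed from the side lengths.
\<close>

section \<open>Closure and cancellation for the chord-and-tangent law\<close>

lemma ec_add_infinity_right [simp]: "ec_add a b P Pt_Infinity = P"
  by (cases P) auto

text \<open>The difference of the two curve equations is divisible by \<open>d = x2 - x1\<close>.
  After cancelling \<open>d\<close>, the claim is a polynomial consequence of what remains.\<close>

lemma chord_on_curve:
  fixes x1 :: "'a::field"
  assumes "y1^2 = x1^3 + a * x1^2 + b * x1 + c" "y2^2 = x2^3 + a * x2^2 + b * x2 + c" "x1 \<noteq> x2"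
    and m: "m = (y2 - y1) / (x2 - x1)" and x3: "x3 = m^2 - a - x1 - x2"
  shows "(m * (x1 - x3) - y1)^2 = x3^3 + a * x3^2 + b * x3 + c"
proof -
  define d where "d = x2 - x1"
  have "d \<noteq> 0" using assms by (simp add: d_def)
  have x2: "x2 = x1 + d" by (simp add: d_def)
  have y2: "y2 = y1 + m * d" using m \<open>d \<noteq> 0\<close> by (simp add: d_def)
  have "d * (2 * m * y1 + m^2 * d) = d * (3*x1^2 + 3*x1*d + d^2 + a * (2*x1 + d) + b)"
    using assms(1,2) unfolding x2 y2 by algebra
  hence "2 * m * y1 + m^2 * d = 3*x1^2 + 3*x1*d + d^2 + a * (2*x1 + d) + b"
    using \<open>d \<noteq> 0\<close> by simp
  thus ?thesis using assms(1) x3 unfolding x2 by algebra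
qed

lemma tangent_on_curve:
  fixes x1 :: "'a::field"
  assumes "y1^2 = x1^3 + a * x1^2 + b * x1 + c" "2 * y1 \<noteq> 0"
    and m: "m = (3 * x1^2 + 2 * a * x1 + b) / (2 * y1)" and x3: "x3 = m^2 - a - x1 - x1"
  shows "(m * (x1 - x3) - y1)^2 = x3^3 + a * x3^2 + b * x3 + c"
proof -
  have "m * (2 * y1) = 3 * x1^2 + 2 * a * x1 + b" using m assms(2) by simp
  thus ?thesis using assms(1) x3 by algebra
qed

lemma ec_add_closed:
  fixes P Q :: "rat ec_point"
  assumes "P \<in> carrier (ec_group a b c)" "Q \<in> carrier (ec_group a b c)"
  shows "ec_add a b P Q \<in> carrier (ec_group a b c)"
proof (cases P; cases Q)
  fix x1 y1 x2 y2
  assume PQ: "P = Pt x1 y1" "Q = Pt x2 y2"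
  have c1: "y1^2 = x1^3 + a * x1^2 + b * x1 + c" and c2: "y2^2 = x2^3 + a * x2^2 + b * x2 + c"
    using assms PQ by (auto simp: ec_group_def)
  show ?thesis
  proof (cases "x1 = x2")
    case False
    then show ?thesis using chord_on_curve[OF c1 c2 False refl refl] PQ
      by (auto simp: ec_group_def Let_def)
  next
    case True
    hence "y1^2 = y2^2" using c1 c2 by simp
    hence "y1 = y2 \<or> y1 = - y2" by (simp add: power2_eq_iff)
    then show ?thesis using True tangent_on_curve[OF c1 _ refl refl] PQ
      by (auto simp: ec_group_def Let_def)
  qed
qed (use assms in auto)

text \<open>If the third intersection has abscissa \<open>x0\<close> again, the chord meets the
  curve doubly at \<open>(x0, y0)\<close>, so it is the tangent there.\<close>

lemma chord_tangent_slope: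
  fixes x1 :: "'a::field"
  assumes "y1^2 = x1^3 + a * x1^2 + b * x1 + c" "y0^2 = x0^3 + a * x0^2 + b * x0 + c" "x1 \<noteq> x0"
    and m: "m = (y0 - y1) / (x0 - x1)" and x3: "x0 = m^2 - a - x1 - x0"
  shows "m * (2 * y0) = 3 * x0^2 + 2 * a * x0 + b"
proof -
  define d where "d = x0 - x1"
  have "d \<noteq> 0" using assms by (simp add: d_def)
  have x1: "x1 = x0 - d" by (simp add: d_def)
  have y1: "y1 = y0 - m * d" using m \<open>d \<noteq> 0\<close> by (simp add: d_def)
  have "d * (2 * m * y0 - m^2 * d) = d * (3*x0^2 - 3*x0*d + d^2 + a * (2*x0 - d) + b)"
    using assms(1,2) unfolding x1 y1 by algebra
  hence "2 * m * y0 - m^2 * d = 3*x0^2 - 3*x0*d + d^2 + a * (2*x0 - d) + b"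
    using \<open>d \<noteq> 0\<close> by simp
  thus ?thesis using x3 unfolding x1 by algebra
qed

text \<open>This instance of associativity stands in for the full group law. Reflecting the line
  through \<open>Q\<close> and \<open>Pt x0 y0\<close> in the axis gives a line of slope
  \<open>- m\<close> through their sum and \<open>Pt x0 (- y0)\<close>; its third point is the
  reflection of \<open>Q\<close>.\<close>

lemma ec_add_cancel:
  fixes x0 :: rat
  assumes Q: "Q \<in> carrier (ec_group a b c)" and S: "Pt x0 y0 \<in> carrier (ec_group a b c)"
    and "y0 \<noteq> 0"
  shows "ec_add a b (ec_add a b Q (Pt x0 y0)) (Pt x0 (- y0)) = Q"
proof (cases Q)
  case Pt_Infinity
  then show ?thesis by simp
next
  case (Pt x1 y1)
  have c1: "y1^2 = x1^3 + a * x1^2 + b * x1 + c" and c0: "y0^2 = x0^3 + a * x0^2 + b * x0 + c"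
    using Q S Pt by (auto simp: ec_group_def)
  show ?thesis
  proof (cases "x1 = x0 \<and> y1 = - y0")
    case True
    then show ?thesis using Pt by simp
  next
    case nopp: False
    define m where "m = (if x1 = x0 then (3 * x1^2 + 2 * a * x1 + b) / (2 * y1)
                    else (y0 - y1) / (x0 - x1))"
    define x3 where "x3 = m^2 - a - x1 - x0"
    define y3 where "y3 = m * (x1 - x3) - y1"
    have R: "ec_add a b Q (Pt x0 y0) = Pt x3 y3"
      using nopp by (auto simp: Pt Let_def m_def x3_def y3_def)
    have same: "y1 = y0" if "x1 = x0"
    proof -
      have "y1^2 = y0^2" using c1 c0 that by simp
      thus ?thesis using nopp that by (auto simp: power2_eq_iff)
    qed
    have y3': "y3 = m * (x0 - x3) - y0"
    proof (cases "x1 = x0")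
      case True thus ?thesis using same by (simp add: y3_def)
    next
      case False
      hence "m * (x0 - x1) = y0 - y1" by (simp add: m_def)
      thus ?thesis unfolding y3_def by algebra
    qed
    show ?thesis
    proof (cases "x3 = x0")
      case True
      \<comment> \<open>The second addition is now a doubling, so \<open>m\<close> has to be
        identified with the tangent slope at \<open>(x0, y0)\<close>.\<close>
      have y3: "y3 = - y0" using y3' True by simp
      have "m * (2 * y0) = 3 * x0^2 + 2 * a * x0 + b"
      proof (cases "x1 = x0")
        case x: True thus ?thesis using same \<open>y0 \<noteq> 0\<close> by (simp add: m_def)
      next
        case x: False
        show ?thesis
          by (rule chord_tangent_slope[OF c1 c0 x]) (use x True x3_def in \<open>simp_all add: m_def\<close>)
      qed
      hence m': "(3 * x0^2 + 2 * a * x0 + b) / (2 * - y0) = - m"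
        using \<open>y0 \<noteq> 0\<close> by (simp add: field_simps)
      have "m^2 = a + x1 + 2 * x0" using x3_def True by simp
      moreover have "- (m * (x0 - x1)) + y0 = y1"
        using y3_def y3 True by (simp add: algebra_simps)
      ultimately show ?thesis unfolding R using True y3 \<open>y0 \<noteq> 0\<close> m' Pt
        by (simp add: Let_def algebra_simps)
    next
      case False
      have m': "(- y0 - y3) / (x0 - x3) = - m"
        using False y3' by (simp add: field_simps)
      have "m^2 - a - x3 - x0 = x1" by (simp add: x3_def)
      moreover have "- m * (x3 - x1) - y3 = y1" by (simp add: y3_def algebra_simps)
      ultimately show ?thesis unfolding R ec_add.simps Let_def using False m' Pt by simp
    qed
  qed
qed

section \<open>Infinitely many points from positive rank\<close>

text \<open>A torsion element would yield a nontrivial relation on \<open>S\<close>, with exponent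
  \<open>n\<close> at \<open>s\<close> and \<open>0\<close> elsewhere.\<close>

lemma Z_independent_nat_pow:
  fixes a b c :: rat
  defines "G \<equiv> ec_group a b c"
  assumes "Z_independent G S" "s \<in> S" "n > 0"
  shows "s [^]\<^bsub>G\<^esub> (n::nat) \<noteq> \<one>\<^bsub>G\<^esub>"
proof
  assume O: "s [^]\<^bsub>G\<^esub> n = \<one>\<^bsub>G\<^esub>"
  define k :: "rat ec_point \<Rightarrow> int" where "k = (\<lambda>x. if x = s then int n else 0)"
  define f where "f = (\<lambda>x. x [^]\<^bsub>G\<^esub> k x)"
  \<comment> \<open>Every factor is the neutral element, so the fold can be evaluated without the
    associativity and commutativity of the group law.\<close>
  have f: "f x = Pt_Infinity" for x
    using O by (auto simp: f_def k_def int_pow_def2 G_def ec_group_def nat_pow_def)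
  have fold_op: "mult G \<circ> f = (\<lambda>x y. y)"
    by (simp add: fun_eq_iff f) (simp add: G_def ec_group_def)
  have fin: "finite S" using assms by (simp add: Z_independent_def)
  \<comment> \<open>\<open>foldD\<close> is a definite description, so the fold value must be shown
    to be unique and to exist.\<close>
  have uniq: "y = \<one>\<^bsub>G\<^esub>" if "(A, y) \<in> foldSetD (carrier G) (mult G \<circ> f) \<one>\<^bsub>G\<^esub>" for A y
    using that by (induction A y rule: foldSetD.induct) (auto simp: fold_op)
  have ex: "(A, \<one>\<^bsub>G\<^esub>) \<in> foldSetD (carrier G) (mult G \<circ> f) \<one>\<^bsub>G\<^esub>" if "finite A" for A
    using that
  proof induction
    case empty
    show ?case by (rule foldSetD.emptyI) (simp add: G_def ec_group_def)
  next
    case (insert x A)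
    have "\<one>\<^bsub>G\<^esub> \<in> carrier G" by (simp add: G_def ec_group_def)
    thus ?case using foldSetD.insertI[of x A "\<lambda>x y. y" "\<one>\<^bsub>G\<^esub>" "carrier G" "\<one>\<^bsub>G\<^esub>"] insert
      by (simp add: fold_op)
  qed
  have "finprod G f S = \<one>\<^bsub>G\<^esub>"
    using fin ex[OF fin] uniq unfolding finprod_def foldD_def by auto
  hence "k s = 0" using assms unfolding Z_independent_def f_def by blast
  thus False using \<open>n > 0\<close> by (simp add: k_def)
qed

text \<open>The multiples of one element \<open>s\<close> of an independent set are pairwise
  distinct: cancelling \<open>s\<close> repeatedly turns a coincidence into a vanishing positive
  multiple.\<close>

lemma infinite_ec_group:
  fixes a b c :: rat
  assumes "ab_rank (ec_group a b c) > 0"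
  shows "infinite (carrier (ec_group a b c))"
proof -
  define G where "G = ec_group a b c"
  obtain S where S: "Z_independent G S" "card S > 0"
    using assms unfolding ab_rank_def G_def[symmetric] by (auto simp: less_SUP_iff zero_enat_def)
  then obtain s where s: "s \<in> S" by fastforce
  have sG: "s \<in> carrier G" using S s by (auto simp: Z_independent_def)
  define p where "p = (\<lambda>n::nat. s [^]\<^bsub>G\<^esub> n)"
  have p0: "p 0 = Pt_Infinity" and pS: "p (Suc n) = ec_add a b (p n) s" for n
    by (auto simp: p_def G_def ec_group_def nat_pow_def)
  have nz: "p n \<noteq> Pt_Infinity" if "n > 0" for n
    using Z_independent_nat_pow[OF S(1)[unfolded G_def] s that]
    by (simp add: p_def G_def) (simp add: ec_group_def)
  have pG: "p n \<in> carrier G" for n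
  proof (induction n)
    case 0 show ?case by (simp add: p0 G_def ec_group_def)
  next
    case (Suc n) then show ?case using sG unfolding pS G_def by (intro ec_add_closed)
  qed
  obtain x0 y0 where s0: "s = Pt x0 y0" using nz[of 1] pS[of 0] p0 by (cases s) auto
  \<comment> \<open>With \<open>y0 = 0\<close> the tangent at \<open>s\<close> would be vertical and
    \<open>p 2\<close> would be the point at infinity.\<close>
  have "y0 \<noteq> 0" using nz[of 2] pS[of 1] pS[of 0] p0 s0 by (auto simp: numeral_2_eq_2)
  have canc: "p m = p n" if "p (Suc m) = p (Suc n)" for m n
    using ec_add_cancel[OF pG[of m, unfolded G_def] _ \<open>y0 \<noteq> 0\<close>, of x0]
      ec_add_cancel[OF pG[of n, unfolded G_def] _ \<open>y0 \<noteq> 0\<close>, of x0] that sG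
    unfolding pS s0 G_def by metis
  have ne: "p m \<noteq> p (m + Suc d)" for m d
  proof (induction m)
    case 0 show ?case using nz[of "Suc d"] p0 by auto
  next
    case (Suc m) thus ?case using canc[of m "m + Suc d"] by auto
  qed
  have "inj p"
  proof (rule injI, rule ccontr)
    fix m n assume "p m = p n" "m \<noteq> n"
    thus False using ne[of m "n - m - 1"] ne[of n "m - n - 1"] by (cases "m < n") auto
  qed
  hence "infinite (range p)" by (simp add: finite_image_iff)
  thus ?thesis using pG finite_subset[of "range p"] unfolding G_def by blast
qed

section \<open>Points with negative abscissa\<close>

lemma finite_square_roots:
  fixes c :: "'a::idom"
  shows "finite {v. v^2 = c}"
proof (cases "\<exists>w. w^2 = c")
  case True
  then obtain w where "w^2 = c" by blast
  hence "{v. v^2 = c} \<subseteq> {w, - w}" by (auto simp: power2_eq_iff)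
  thus ?thesis using finite_subset by blast
qed auto

text \<open>Translation by \<open>(0, 0)\<close> sends \<open>u\<close> to \<open>b / u\<close> and
  changes its sign. Finitely many negative abscissae would leave finitely many abscissae in all,
  each carrying at most two points.\<close>

lemma infinite_negative_abscissae:
  fixes a b :: rat
  assumes "infinite (carrier (ec_group a b 0))" "b < 0"
  shows "infinite {u. u < 0 \<and> (\<exists>v. v^2 = u^3 + a * u^2 + b * u)}"
proof
  define X where "X = {u. \<exists>v. v^2 = u^3 + a * u^2 + b * u}"
  assume fin: "finite {u. u < 0 \<and> (\<exists>v. v^2 = u^3 + a * u^2 + b * u)}" (is "finite ?V")
  have "X \<subseteq> insert 0 (?V \<union> (\<lambda>u. b / u) ` ?V)"
  proof
    fix u assume "u \<in> X"
    then obtain v where v: "v^2 = u^3 + a * u^2 + b * u" by (auto simp: X_def)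
    show "u \<in> insert 0 (?V \<union> (\<lambda>u. b / u) ` ?V)"
    proof (cases "u > 0")
      case True
      define w where "w = b / u"
      have "w * u = b" using True by (simp add: w_def)
      \<comment> \<open>Up to sign, \<open>w * v / u\<close> is the ordinate of the translated
        point.\<close>
      have "(w * v)^2 = w^2 * (u^3 + a * u^2 + w * u * u)"
        using v \<open>w * u = b\<close> by (simp add: power_mult_distrib)
      also have "\<dots> = u^2 * (w^3 + a * w^2 + w * u * w)" by algebra
      finally have "(w * v)^2 = u^2 * (w^3 + a * w^2 + b * w)" unfolding \<open>w * u = b\<close> .
      hence "(w * v / u)^2 = w^3 + a * w^2 + b * w" using True by (simp add: power_divide)
      hence "\<exists>v. v^2 = (b / u)^3 + a * (b / u)^2 + b * (b / u)" unfolding w_def by blast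
      moreover have "b / u < 0" using True \<open>b < 0\<close> by (simp add: divide_neg_pos)
      ultimately have "b / u \<in> ?V" by blast
      moreover have "u = b / (b / u)" using \<open>b < 0\<close> by simp
      ultimately show ?thesis by blast
    next
      case False
      thus ?thesis using v by (cases "u = 0") auto
    qed
  qed
  hence "finite X" by (rule finite_subset) (use fin in simp)
  moreover have "carrier (ec_group a b 0) \<subseteq>
      insert Pt_Infinity (\<Union>u\<in>X. Pt u ` {v. v^2 = u^3 + a * u^2 + b * u})"
    by (auto simp: ec_group_def X_def)
  moreover have "finite (insert Pt_Infinity (\<Union>u\<in>X. Pt u ` {v. v^2 = u^3 + a * u^2 + b * u}))"
    using \<open>finite X\<close> finite_square_roots by blast
  ultimately show False using assms(1) finite_subset by blast
qed

section \<open>Tangent lengths from a point of the curve\<close>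

text \<open>The closing disjunction expresses \<open>t\<close>, and thereby \<open>u\<close>,
  through the triangle; its cases match \<open>t > 1\<close> and \<open>t < 1\<close>. The excluded
  abscissa is the one with \<open>t = 1\<close>.\<close>

lemma tangent_lengths_of_point:
  fixes N u v :: rat
  assumes N: "N > 1 / 4" and u: "u < 0" "u \<noteq> 1 - 4 * N"
    and v: "v^2 = u^3 + 2 * (2 * N^2 + 2 * N - 1) * u^2 + - (4 * N - 1) * u"
  defines "t \<equiv> (1 - u) / (4 * N)"
  obtains x y z where "x > 0" "y > 0" "z > 0"
    "(x + y) * (y + z) * (z + x) = 4 * N * (x + y + z) * x * y"
    "x + y + z = t * (x + y) \<or> y = t * (y + z)"
proof -
  have "N > 0" using N by simp
  have "t > 0" using u \<open>N > 0\<close> by (simp add: t_def)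
  have "t \<noteq> 1" using u \<open>N > 0\<close> by (auto simp: t_def field_simps)
  have ut: "u = 1 - 4 * N * t" using \<open>N > 0\<close> by (simp add: t_def)
  define q where "q = t * (t - 1) / (- u)"
  have q: "q * u = - (t * (t - 1))" using u by (simp add: q_def)
  \<comment> \<open>The absolute value makes \<open>x\<close> the larger root of the quadratic with
    sum \<open>1\<close> and product \<open>q\<close>. So \<open>x > 0\<close>, and \<open>y\<close>
    has the sign of \<open>q\<close>.\<close>
  define d where "d = \<bar>v / (2 * N * u)\<bar>"
  have d: "d^2 = 1 - 4 * q"
  proof -
    have "(2 * N * u)^2 * d^2 = v^2"
      using u \<open>N > 0\<close> by (simp add: d_def power_divide)
    also have "\<dots> = (2 * N * u)^2 * (1 - 4 * q)"
      using v q unfolding ut by algebra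
    finally show ?thesis using u \<open>N > 0\<close> by simp
  qed
  have "d \<ge> 0" by (simp add: d_def)
  define x y where "x = (1 + d) / 2" and "y = (1 - d) / 2"
  have "x > 0" using \<open>d \<ge> 0\<close> by (simp add: x_def)
  have xy1: "x + y = 1" by (simp add: x_def y_def field_simps)
  have xyq: "x * y = q"
    using d by (simp add: x_def y_def field_simps power2_eq_square)
  \<comment> \<open>As \<open>x + y = 1\<close>, this reads
    \<open>q + t * (t - 1) = 4 * N * t * q\<close>, which is
    \<open>q * u = - (t * (t - 1))\<close>.\<close>
  have eq: "(x + y) * (y + (t - 1)) * ((t - 1) + x) = 4 * N * (x + y + (t - 1)) * x * y"
    using xy1 xyq q ut by algebra
  show ?thesis
  proof (cases "t > 1")
    case True
    have "q > 0" using True u by (simp add: q_def divide_pos_neg)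
    hence "y > 0" using xyq \<open>x > 0\<close> by (metis zero_less_mult_pos)
    show ?thesis
      by (rule that[of x y "t - 1"]) (use True eq xy1 \<open>x > 0\<close> \<open>y > 0\<close> in auto)
  next
    case False
    hence "t < 1" using \<open>t \<noteq> 1\<close> by simp
    hence "t * (t - 1) < 0" using \<open>t > 0\<close> by (simp add: mult_pos_neg)
    hence "q < 0" unfolding q_def by (rule divide_neg_pos) (use u in simp)
    hence "y < 0" using xyq \<open>x > 0\<close> by (metis not_less_iff_gr_or_eq mult_pos_pos mult_zero_right)
    \<comment> \<open>The solution \<open>(x, y, t - 1)\<close> has one positive entry; \<open>(- y, x + y + (t - 1), 1 - t)\<close>
      is again a solution, and it is positive.\<close>
    have "(- y + t) * (t + (1 - t)) * ((1 - t) + - y) = 4 * N * (- y + t + (1 - t)) * - y * t"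
      using eq xy1 by algebra
    thus ?thesis
      using that[of "- y" t "1 - t"] \<open>y < 0\<close> \<open>t < 1\<close> \<open>t > 0\<close> by simp
  qed
qed

section \<open>The triangle and its circles in coordinates\<close>

text \<open>The parameter \<open>q\<close> marks the foot of the perpendicular from
  \<open>Z\<close>. By Pythagoras the squared distance from \<open>Z\<close> to the point with
  parameter \<open>k\<close> exceeds \<open>r^2\<close> by \<open>(k - q)^2\<close> times the
  squared length of \<open>Y - X\<close>.\<close>

lemma tangent_atI:
  fixes X Y Z :: "real^2"
  assumes "X \<noteq> Y" "r > 0" and q: "(Z - X) \<bullet> (Y - X) = q * ((Y - X) \<bullet> (Y - X))"
    and r: "(Z - X) \<bullet> (Z - X) = r^2 + q^2 * ((Y - X) \<bullet> (Y - X))"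
  shows "tangent_at Z r X Y (X + q *\<^sub>R (Y - X))"
proof -
  define W where "W = Y - X"
  have W: "W \<bullet> W > 0" using assms(1) by (simp add: W_def)
  have "dist Z (X + k *\<^sub>R W) = r \<longleftrightarrow> k = q" for k
  proof -
    have "dist Z (X + k *\<^sub>R W) = r \<longleftrightarrow> (dist Z (X + k *\<^sub>R W))^2 = r^2"
      using \<open>r > 0\<close> by (simp add: power2_eq_iff_nonneg)
    also have "(dist Z (X + k *\<^sub>R W))^2 = ((Z - X) - k *\<^sub>R W) \<bullet> ((Z - X) - k *\<^sub>R W)"
      by (simp add: dist_norm power2_norm_eq_inner algebra_simps)
    also have "\<dots> = (Z - X) \<bullet> (Z - X) - 2 * k * ((Z - X) \<bullet> W) + k^2 * (W \<bullet> W)"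
      by (simp add: inner_diff_left inner_diff_right inner_commute power2_eq_square algebra_simps)
    also have "\<dots> = r^2 + (k - q)^2 * (W \<bullet> W)"
      using q r unfolding W_def[symmetric] by algebra
    finally show ?thesis using W by simp
  qed
  thus ?thesis
    unfolding tangent_at_def affine_hull_2_alt W_def[symmetric] by auto
qed

text \<open>Here \<open>x\<close>, \<open>y\<close>, \<open>z\<close> are the tangent lengths from
  \<open>A\<close>, \<open>B\<close>, \<open>C\<close> to the incircle, and \<open>s\<close> is the
  semiperimeter. Coordinates with \<open>A B\<close> on the first axis reduce everything to
  polynomial identities.\<close>

lemma triangle_of_tangent_lengths:
  fixes x y z N :: real
  assumes pos: "x > 0" "y > 0" "z > 0"
    and N: "(x + y) * (y + z) * (z + x) = 4 * N * (x + y + z) * x * y"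
  obtains A B C where "nondegenerate (A, B, C)" "radius_ratio (A, B, C) N"
    "dist B C = y + z" "dist C A = z + x" "dist A B = x + y"
proof -
  define s where "s = x + y + z"
  define h where "h = x + y"
  \<comment> \<open>By Heron the area is \<open>sqrt (s * x * y * z)\<close>. Then \<open>r\<close>
    is the area over \<open>z\<close>, the height \<open>w\<close> of \<open>C\<close> is twice the
    area over \<open>h\<close>, and \<open>p\<close> is the foot of that height.\<close>
  define r where "r = sqrt (s * x * y / z)"
  define p where "p = x + z * (x - y) / h"
  define w where "w = 2 * r * z / h"
  \<comment> \<open>\<open>k\<close> makes \<open>K\<close> equidistant from \<open>A\<close> and
    \<open>C\<close>; \<open>R\<close> is the product of the sides at \<open>C\<close> over twice
    the height from \<open>C\<close>.\<close>
  define k where "k = ((z + x)^2 - h * p) / (2 * w)"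
  define R where "R = (y + z) * (z + x) / (2 * w)"
  \<comment> \<open>\<open>Z\<close> is the excentre, with touching point \<open>(y, 0)\<close> on \<open>A B\<close>; \<open>K\<close> is the circumcentre.\<close>
  define A B C Z K :: "real^2" where "A = 0" and "B = vector [h, 0]" and "C = vector [p, w]"
    and "Z = vector [y, - r]" and "K = vector [h / 2, k]"
  have "s > 0" "h > 0" using pos by (auto simp: s_def h_def)
  have "r > 0" using pos \<open>s > 0\<close> by (simp add: r_def)
  have "w > 0" using \<open>r > 0\<close> \<open>h > 0\<close> pos by (simp add: w_def)
  have "R > 0" using \<open>w > 0\<close> pos by (simp add: R_def)
  have r2: "r^2 * z = s * x * y" using pos \<open>s > 0\<close> by (simp add: r_def)
  have hp: "h * p = x * h + z * (x - y)" using \<open>h > 0\<close> by (simp add: p_def field_simps)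
  have hw: "h * w = 2 * r * z" using \<open>h > 0\<close> by (simp add: w_def)
  have CA2: "p^2 + w^2 = (z + x)^2"
  proof -
    have "h^2 * (p^2 + w^2) = h^2 * (z + x)^2"
      using hp hw r2 s_def h_def by algebra
    thus ?thesis using \<open>h > 0\<close> by simp
  qed
  have BC2: "(h - p)^2 + w^2 = (y + z)^2"
    using CA2 hp h_def by algebra
  \<comment> \<open>This is the inner product of \<open>Z - A\<close> and \<open>C - A\<close>: the
    excentre projects onto the line \<open>C A\<close> at distance \<open>y\<close> beyond
    \<open>A\<close>.\<close>
  have yp: "y * p - r * w = - (y * (z + x))"
  proof -
    have "h * (y * p - r * w) = h * (- (y * (z + x)))"
      using hp hw r2 s_def h_def by algebra
    thus ?thesis using \<open>h > 0\<close> by (metis mult_left_cancel less_irrefl)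
  qed
  have k: "2 * w * k = (z + x)^2 - h * p" using \<open>w > 0\<close> by (simp add: k_def)
  have R: "2 * w * R = (y + z) * (z + x)" using \<open>w > 0\<close> by (simp add: R_def)
  have KR: "(h / 2)^2 + k^2 = R^2"
  proof -
    have "4 * w^2 * R^2 = ((y + z) * (z + x))^2" unfolding R[symmetric] by (simp add: power_mult_distrib)
    also have "\<dots> = h^2 * w^2 + ((z + x)^2 - h * p)^2"
      using hp hw r2 s_def h_def by algebra
    also have "\<dots> = 4 * w^2 * ((h / 2)^2 + k^2)"
      unfolding k[symmetric] by (simp add: power2_eq_square algebra_simps)
    finally show ?thesis using \<open>w > 0\<close> by simp
  qed
  note vec = A_def B_def C_def Z_def K_def inner_vec_def sum_2 vector_2
  have AB: "dist A B = h"
    using \<open>h > 0\<close> by (simp add: dist_norm norm_eq_sqrt_inner vec)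
  have CA: "dist C A = z + x"
    using CA2 pos by (simp add: dist_norm norm_eq_sqrt_inner vec flip: power2_eq_square)
  have BC: "dist B C = y + z"
    using BC2 pos by (simp add: dist_norm norm_eq_sqrt_inner vec flip: power2_eq_square)
  have nd: "\<not> collinear {A, B, C}"
  proof
    assume "collinear {A, B, C}"
    then consider "B = 0" | "C = 0" | c where "C = c *\<^sub>R B"
      unfolding A_def collinear_lemma by blast
    hence "C $ 2 = 0 \<or> B = 0" by cases (auto simp: B_def vector_2)
    thus False using AB \<open>w > 0\<close> \<open>h > 0\<close> by (auto simp: A_def C_def vector_2)
  qed
  have circ: "is_circumradius (A, B, C) R"
  proof -
    have sq: "dist K V = R" if "(K - V) \<bullet> (K - V) = R^2" for V
      using that \<open>R > 0\<close> by (simp add: dist_norm norm_eq_sqrt_inner)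
    have "(h / 2 - p)^2 + (k - w)^2 = R^2" using k CA2 KR by algebra
    hence "dist K C = R" by (intro sq) (simp add: vec power2_eq_square)
    moreover have "dist K A = R" by (rule sq) (use KR in \<open>simp add: vec power2_eq_square\<close>)
    moreover have "dist K B = R" by (rule sq) (use KR in \<open>simp add: vec power2_eq_square\<close>)
    ultimately show ?thesis by auto
  qed
  have inn: "(Z - A) \<bullet> (B - A) = y * h" "(Z - A) \<bullet> (Z - A) = r^2 + y^2"
    "(Z - C) \<bullet> (A - C) = (z + x)^2 - (y * p - r * w)"
    "(Z - C) \<bullet> (B - C) = y * h - (y * p - r * w) - h * p + (z + x)^2"
    "(Z - C) \<bullet> (Z - C) = r^2 + y^2 - 2 * (y * p - r * w) + (z + x)^2"
    unfolding CA2[symmetric] by (simp_all add: vec power2_eq_square algebra_simps)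
  have sq: "(B - A) \<bullet> (B - A) = h^2" "(A - C) \<bullet> (A - C) = (z + x)^2" "(B - C) \<bullet> (B - C) = (y + z)^2"
    using AB CA BC by (simp_all add: dist_norm norm_minus_commute flip: power2_norm_eq_inner)
  have ne: "A \<noteq> B" "C \<noteq> A" "C \<noteq> B" using AB CA BC pos \<open>h > 0\<close> by auto
  have beyond: "Y \<in> open_segment X (X + q *\<^sub>R (Y - X))" if "q > 1" "X \<noteq> Y" for X Y :: "real^2" and q
  proof -
    have "Y = (1 - 1 / q) *\<^sub>R X + (1 / q) *\<^sub>R (X + q *\<^sub>R (Y - X))"
      using that by (simp add: algebra_simps)
    thus ?thesis using that unfolding in_segment by (auto intro!: exI[of _ "1 / q"])
  qed
  have scale: "s / e * e^2 = s * e" "(s / e)^2 * e^2 = s^2" if "e \<noteq> 0" for e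
    using that by (simp_all add: power2_eq_square)
  have zx: "z + x \<noteq> 0" and yz: "y + z \<noteq> 0" using pos by simp_all
  have ex: "is_exradius (A, B, C) r"
  proof -
    have "tangent_at Z r A B (A + (y / h) *\<^sub>R (B - A))"
      by (rule tangent_atI)
        (use ne inn sq \<open>r > 0\<close> \<open>h > 0\<close> in \<open>simp_all add: power2_eq_square\<close>)
    moreover have "A + (y / h) *\<^sub>R (B - A) \<in> open_segment A B"
      using ne pos unfolding in_segment
      by (auto intro!: exI[of _ "y / h"] simp: h_def algebra_simps)
    \<comment> \<open>Both tangents from \<open>C\<close> to the excircle have length
      \<open>s\<close>; dividing by the side length gives the parameter of the touching
      point.\<close>
    moreover have "tangent_at Z r C A (C + (s / (z + x)) *\<^sub>R (A - C))"
    proof (rule tangent_atI)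
      show "(Z - C) \<bullet> (A - C) = s / (z + x) * ((A - C) \<bullet> (A - C))"
        unfolding inn sq yp scale(1)[OF zx] using s_def by algebra
      show "(Z - C) \<bullet> (Z - C) = r^2 + (s / (z + x))^2 * ((A - C) \<bullet> (A - C))"
        unfolding inn sq yp scale(2)[OF zx] using s_def by algebra
    qed (use ne \<open>r > 0\<close> in auto)
    moreover have "tangent_at Z r C B (C + (s / (y + z)) *\<^sub>R (B - C))"
    proof (rule tangent_atI)
      show "(Z - C) \<bullet> (B - C) = s / (y + z) * ((B - C) \<bullet> (B - C))"
        unfolding inn sq yp hp scale(1)[OF yz] using s_def h_def by algebra
      show "(Z - C) \<bullet> (Z - C) = r^2 + (s / (y + z))^2 * ((B - C) \<bullet> (B - C))"
        unfolding inn sq yp scale(2)[OF yz] using s_def by algebra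
    qed (use ne \<open>r > 0\<close> in auto)
    moreover have "A \<in> open_segment C (C + (s / (z + x)) *\<^sub>R (A - C))"
      using ne pos by (intro beyond) (auto simp: s_def)
    moreover have "B \<in> open_segment C (C + (s / (y + z)) *\<^sub>R (B - C))"
      using ne pos by (intro beyond) (auto simp: s_def)
    ultimately show ?thesis using \<open>r > 0\<close> unfolding is_exradius.simps by blast
  qed
  have "R / r = N"
  proof -
    have "4 * (r^2 * z) * R = r * (2 * (h * w) * R)" unfolding hw by (simp add: power2_eq_square)
    also have "\<dots> = r * h * (2 * w * R)" by simp
    also have "\<dots> = r * (4 * N * s * x * y)"
      unfolding R using N by (simp add: h_def s_def mult_ac)
    finally have "(4 * (s * x * y)) * R = (4 * (s * x * y)) * (r * N)" unfolding r2 by simp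
    moreover have "4 * (s * x * y) \<noteq> 0" using pos \<open>s > 0\<close> by simp
    ultimately have "R = r * N" by (metis mult_left_cancel)
    thus ?thesis using \<open>r > 0\<close> by simp
  qed
  hence "radius_ratio (A, B, C) N" using circ ex unfolding radius_ratio_def by blast
  thus ?thesis using that nd AB CA BC unfolding h_def by auto
qed

section \<open>A finite similarity invariant\<close>

text \<open>\<open>similar\<close> matches vertex sets only, so the invariant must ignore labels.
  The two shapes are those in which \<open>2 * t\<close> appears: \<open>(f + g + h) / h\<close> and
  \<open>(f + h - g) / f\<close>.\<close>

definition ratios :: "real set \<Rightarrow> real set" where
  "ratios D = (\<Union>a\<in>D. \<Union>b\<in>D. \<Union>c\<in>D. \<Union>d\<in>D. {(a + b + c) / d, (a + b - c) / d})"

lemma ratiosI: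
  assumes "a \<in> D" "b \<in> D" "c \<in> D" "d \<in> D"
  shows "(a + b + c) / d \<in> ratios D" "(a + b - c) / d \<in> ratios D"
  unfolding ratios_def using assms by auto

fun distances :: "plane_triangle \<Rightarrow> real set" where
  "distances (A, B, C) = (\<Union>P\<in>{A, B, C}. \<Union>Q\<in>{A, B, C}. {dist P Q})"

lemma finite_ratios_distances: "finite (ratios (distances T))"
proof -
  have "finite (distances T)" by (cases T) simp
  thus ?thesis by (simp add: ratios_def)
qed

lemma ratios_scale:
  assumes "k > 0"
  shows "ratios ((\<lambda>d. k * d) ` D) = ratios D"
  using assms unfolding ratios_def
  by (simp flip: distrib_left right_diff_distrib)

lemma ratios_similar:
  assumes "similar T T'"
  shows "ratios (distances T) = ratios (distances T')"
proof -
  obtain A B C A' B' C' where T: "T = (A, B, C)" "T' = (A', B', C')" by (cases T; cases T')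
  obtain k F where "k > 0" and F: "\<And>x y. dist (F x) (F y) = k * dist x y"
    "F ` {A, B, C} = {A', B', C'}" using assms unfolding T by auto
  have "distances T' = (\<lambda>d. k * d) ` distances T"
    unfolding T distances.simps F(2)[symmetric] by (simp add: F(1) image_UN)
  thus ?thesis using ratios_scale[OF \<open>k > 0\<close>] by simp
qed

text \<open>One triangle is chosen for each value of the invariant, so the chosen ones are pairwise
  dissimilar. Each value is a finite set, hence finitely many of them cannot cover
  \<open>U\<close>.\<close>

lemma infinitely_many_trianglesI:
  assumes "infinite U" "\<And>u. u \<in> U \<Longrightarrow> \<exists>T. P T \<and> u \<in> ratios (distances T)"
  shows "infinitely_many_triangles P"
proof -
  define \<Phi> where "\<Phi> = (\<lambda>T. ratios (distances T))"
  obtain \<T> where \<T>: "\<T> \<subseteq> {T. P T}" "inj_on \<Phi> \<T>" "\<Phi> ` {T. P T} = \<Phi> ` \<T>"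
    by (metis subset_image_inj subset_refl)
  have "U \<subseteq> (\<Union>T\<in>\<T>. \<Phi> T)"
  proof
    fix u assume "u \<in> U"
    then obtain T where "P T" "u \<in> \<Phi> T" using assms(2) unfolding \<Phi>_def by blast
    moreover from this obtain T' where "T' \<in> \<T>" "\<Phi> T = \<Phi> T'" using \<T>(3) by blast
    ultimately show "u \<in> (\<Union>T\<in>\<T>. \<Phi> T)" by auto
  qed
  hence "infinite \<T>"
    using assms(1) finite_ratios_distances finite_subset unfolding \<Phi>_def by (metis finite_UN_I)
  moreover have "pairwise (\<lambda>T T'. \<not> similar T T') \<T>"
    using \<T>(2) ratios_similar unfolding pairwise_def inj_on_def \<Phi>_def by blast
  ultimately show ?thesis using \<T>(1) unfolding infinitely_many_triangles_def by blast
qed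

section \<open>Integer triangles and the conclusion\<close>

lemma rat_common_denominator:
  fixes x y z :: rat
  obtains k :: rat where "k > 0" "k * x \<in> \<int>" "k * y \<in> \<int>" "k * z \<in> \<int>"
proof -
  have ex: "\<exists>b::int. b > 0 \<and> of_int b * q \<in> \<int>" for q :: rat
    by (cases q) (auto simp: Fract_of_int_quotient intro!: exI)
  obtain a b c :: int where abc: "a > 0" "of_int a * x \<in> \<int>" "b > 0" "of_int b * y \<in> \<int>"
    "c > 0" "of_int c * z \<in> \<int>" using ex by meson
  show ?thesis
  proof (rule that[of "of_int (a * b * c)"])
    have "of_int (a * b * c) * x = of_int (b * c) * (of_int a * x)"
      "of_int (a * b * c) * y = of_int (a * c) * (of_int b * y)"
      "of_int (a * b * c) * z = of_int (a * b) * (of_int c * z)" by simp_all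
    thus "of_int (a * b * c) * x \<in> \<int>" "of_int (a * b * c) * y \<in> \<int>" "of_int (a * b * c) * z \<in> \<int>"
      using abc by (metis Ints_mult Ints_of_int)+
  qed (use abc in simp)
qed

text \<open>Denominators can be cleared because the cubic equation and the relations for
  \<open>t\<close> are homogeneous. The listed ratio is \<open>2 * t\<close>, which determines
  \<open>u\<close>.\<close>

lemma integer_triangle_of_point:
  fixes N u v :: rat
  assumes "N > 1 / 4" "u < 0" "u \<noteq> 1 - 4 * N"
    and "v^2 = u^3 + 2 * (2 * N^2 + 2 * N - 1) * u^2 + - (4 * N - 1) * u"
  shows "\<exists>T. (integer_triangle T \<and> radius_ratio T (of_rat N)) \<and>
    of_rat ((1 - u) / (2 * N)) \<in> ratios (distances T)"
proof -
  define t where "t = (1 - u) / (4 * N)"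
  obtain x0 y0 z0 where pos0: "x0 > 0" "y0 > 0" "z0 > 0"
    and eq0: "(x0 + y0) * (y0 + z0) * (z0 + x0) = 4 * N * (x0 + y0 + z0) * x0 * y0"
    and t0: "x0 + y0 + z0 = t * (x0 + y0) \<or> y0 = t * (y0 + z0)"
    using tangent_lengths_of_point[OF assms] unfolding t_def by blast
  obtain k where k: "k > 0" "k * x0 \<in> \<int>" "k * y0 \<in> \<int>" "k * z0 \<in> \<int>"
    by (rule rat_common_denominator)
  define x y z where "x = k * x0" and "y = k * y0" and "z = k * z0"
  have pos: "x > 0" "y > 0" "z > 0" using pos0 k by (auto simp: x_def y_def z_def)
  have eq: "(x + y) * (y + z) * (z + x) = 4 * N * (x + y + z) * x * y"
    using eq0 unfolding x_def y_def z_def by algebra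
  have t: "x + y + z = t * (x + y) \<or> y = t * (y + z)"
    using t0 unfolding x_def y_def z_def by algebra
  define X Y Z T :: real where "X = of_rat x" and "Y = of_rat y" and "Z = of_rat z" and "T = of_rat t"
  have POS: "X > 0" "Y > 0" "Z > 0" using pos by (auto simp: X_def Y_def Z_def)
  have Int: "X \<in> \<int>" "Y \<in> \<int>" "Z \<in> \<int>"
    using k unfolding X_def Y_def Z_def x_def y_def z_def by (auto elim!: Ints_cases)
  have "(X + Y) * (Y + Z) * (Z + X) = 4 * of_rat N * (X + Y + Z) * X * Y"
    using arg_cong[OF eq, of "of_rat :: rat \<Rightarrow> real"]
    by (simp add: X_def Y_def Z_def of_rat_mult of_rat_add)
  then obtain A B C where ABC: "nondegenerate (A, B, C)" "radius_ratio (A, B, C) (of_rat N)"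
    "dist B C = Y + Z" "dist C A = Z + X" "dist A B = X + Y"
    using triangle_of_tangent_lengths[OF POS] by blast
  have "X + Y + Z = T * (X + Y) \<or> Y = T * (Y + Z)"
    using t by (metis X_def Y_def Z_def T_def of_rat_mult of_rat_add)
  hence "2 * T = (dist B C + dist C A + dist A B) / dist A B \<or>
      2 * T = (dist B C + dist A B - dist C A) / dist B C"
    using POS unfolding ABC by (auto simp: field_simps)
  hence "2 * T \<in> ratios (distances (A, B, C))"
    by (auto intro!: ratiosI)
  moreover have "2 * T = of_rat ((1 - u) / (2 * N))"
    unfolding T_def t_def by (simp add: of_rat_divide of_rat_mult)
  ultimately have "of_rat ((1 - u) / (2 * N)) \<in> ratios (distances (A, B, C))" by simp
  moreover have "integer_triangle (A, B, C)"
    using ABC Int by (simp add: integer_triangle_def)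
  ultimately show ?thesis using ABC(2) by blast
qed

theorem corollary10:
  fixes N :: rat
  assumes "N > 1 / 4"
    and "ab_rank (curve_E N) > 0"
  shows "infinitely_many_triangles (\<lambda>T. rational_triangle T \<and> radius_ratio T (of_rat N)) \<and>
         infinitely_many_triangles (\<lambda>T. integer_triangle T \<and> radius_ratio T (of_rat N))"
proof -
  define a b where "a = 2 * (2 * N^2 + 2 * N - 1)" and "b = - (4 * N - 1)"
  \<comment> \<open>Removing \<open>1 - 4 * N\<close>, where \<open>t = 1\<close> and the
    construction degenerates, costs a single abscissa.\<close>
  define V where "V = {u. u < 0 \<and> (\<exists>v. v^2 = u^3 + a * u^2 + b * u)} - {1 - 4 * N}"
  define U where "U = (\<lambda>u. of_rat ((1 - u) / (2 * N)) :: real) ` V"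
  have "b < 0" using assms(1) by (simp add: b_def)
  have "infinite (carrier (ec_group a b 0))"
    using assms(2) infinite_ec_group unfolding curve_E_def a_def b_def by blast
  hence "infinite V" using infinite_negative_abscissae[OF _ \<open>b < 0\<close>] by (simp add: V_def)
  moreover have "inj_on (\<lambda>u. of_rat ((1 - u) / (2 * N)) :: real) V"
    using assms(1) by (auto simp: inj_on_def)
  ultimately have "infinite U" unfolding U_def by (simp add: finite_image_iff)
  hence int: "infinitely_many_triangles (\<lambda>T. integer_triangle T \<and> radius_ratio T (of_rat N))"
    by (rule infinitely_many_trianglesI)
      (use integer_triangle_of_point[OF assms(1)] in \<open>auto simp: U_def V_def a_def b_def\<close>)
  \<comment> \<open>The same dissimilar family serves for both claims.\<close>
  have "rational_triangle T" if "integer_triangle T" for T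
    using that Ints_subset_Rats
    by (cases T) (auto simp: integer_triangle_def rational_triangle_def)
  hence "infinitely_many_triangles (\<lambda>T. rational_triangle T \<and> radius_ratio T (of_rat N))"
    using int unfolding infinitely_many_triangles_def by blast
  thus ?thesis using int by blast
qed

end
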